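(* Let $H$ be a non-cyclic abelian group of order $n > 1$ such that $n$ is not a prime integer, i.e., $H \cong Z_{m_1}\oplus\cdots\oplus Z_{m_i}$ with $i \geq 2$, $m_1 \geq 2$, $m_1 \mid m_2 \mid \cdots \mid m_i$, and $n = m_1\cdots m_i$. Let $m > 1$ be a positive integer such that every prime factor of $n$ is a prime factor of $m$, and let $k = \gcd(m,n)$. For each $1 \leq j \leq i$, let $d_j = \gcd(m,m_j) = \gcd(k,m_j)$. Then the graphs $m\text{-}G(H)$, $k\text{-}G(H)$ and $(d_1,\dots,d_i)\text{-}PG(H)$ are isomorphic: $m\text{-}G(H) \cong k\text{-}G(H) \cong (d_1,\dots,d_i)\text{-}PG(H)$.
   Context: $Z_r$ is the additive cyclic group of integers modulo $r$. For a finite abelian group $H$ (written additively) and an integer $r>1$, the graph $r\text{-}G(H)$ is the simple undirected graph with vertex set $H$ in which two distinct vertices $a,b$ are adjacent if and only if $ra=b$ or $rb=a$. For $H = Z_{m_1}\oplus\cdots\oplus Z_{m_i}$ with $i\ge 2$, $m_1\ge 2$, $m_1\mid m_2\mid\cdots\mid m_i$, and for integers $d_j\geq 2$ ($1\le j\le i$) such that $d_j \mid m_j$ and every prime factor of $m_j$ is a prime factor of $d_j$, the $(d_1,\dots,d_i)$-product graph $(d_1,\dots,d_i)\text{-}PG(H)$ is the simple undirected graph with vertex set $H$ in which two distinct vertices $x=(x_1,\dots,x_i)$, $y=(y_1,\dots,y_i)$ are adjacent if and only if $y=(d_1x_1,\dots,d_ix_i)$ or $x=(d_1y_1,\dots,d_iy_i)$.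 For $H\cong Z_{m_1}\oplus\cdots\oplus Z_{m_i}$, $(d_1,\dots,d_i)\text{-}PG(H)$ denotes this graph on $Z_{m_1}\oplus\cdots\oplus Z_{m_i}$. *)

theory Defs
  imports
    "HOL-Algebra.Product_Groups"
    "HOL-Computational_Algebra.Primes"
    "Graph_Theory.Graph_Theory"
begin

text \<open>
  As in \<^theory>\<open>Graph_Theory.Digraph\<close>, a simple undirected graph is a symmetric loop-free digraph
  without parallel arcs: an undirected edge \<open>{a, b}\<close> is the pair of arcs \<open>(a, b)\<close> and \<open>(b, a)\<close>.

  Groups of HOL-Algebra are written multiplicatively, so \<open>r a\<close> of an additive group \<open>H\<close> is
  \<open>a [^]\<^bsub>H\<^esub> r\<close>. The first graph below is \<open>r-G(H)\<close>.
\<close>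

definition mult_graph :: "nat \<Rightarrow> ('a, 'b) monoid_scheme \<Rightarrow> 'a pair_pre_digraph"
  where "mult_graph r H =
    \<lparr> pverts = carrier H,
      parcs = {(a, b). a \<in> carrier H \<and> b \<in> carrier H \<and> a \<noteq> b \<and>
                       (a [^]\<^bsub>H\<^esub> r = b \<or> b [^]\<^bsub>H\<^esub> r = a)} \<rparr>"

text \<open>
  \<open>Z\<^bsub>ms 1\<^esub> \<oplus> \<dots> \<oplus> Z\<^bsub>ms i\<^esub>\<close>; its elements are functions on \<open>{1..i}\<close>, extensional outside.
\<close>

definition cyclic_sum :: "nat \<Rightarrow> (nat \<Rightarrow> nat) \<Rightarrow> (nat \<Rightarrow> int) monoid"
  where "cyclic_sum i ms = sum_group {1..i} (\<lambda>j. integer_mod_group (ms j))"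

text \<open>\<open>(d\<^sub>1 x\<^sub>1, \<dots>, d\<^sub>i x\<^sub>i)\<close>, where \<open>d\<^sub>j x\<^sub>j\<close> is computed in \<open>Z\<^bsub>ms j\<^esub>\<close>:\<close>

definition comp_mult :: "nat \<Rightarrow> (nat \<Rightarrow> nat) \<Rightarrow> (nat \<Rightarrow> nat) \<Rightarrow> (nat \<Rightarrow> int) \<Rightarrow> (nat \<Rightarrow> int)"
  where "comp_mult i ms d x = (\<lambda>j\<in>{1..i}. x j [^]\<^bsub>integer_mod_group (ms j)\<^esub> d j)"

text \<open>
  The product graph \<open>(d\<^sub>1, \<dots>, d\<^sub>i)-PG\<close> of that sum. It is meant for \<open>d j \<ge> 2\<close> with \<open>d j dvd ms j\<close>
  and every prime factor of \<open>ms j\<close> dividing \<open>d j\<close>; \<open>gcd_admissible\<close> below shows that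
  \<open>d j = gcd m (ms j)\<close> satisfies this.
\<close>

definition product_graph :: "nat \<Rightarrow> (nat \<Rightarrow> nat) \<Rightarrow> (nat \<Rightarrow> nat) \<Rightarrow> (nat \<Rightarrow> int) pair_pre_digraph"
  where "product_graph i d ms =
    \<lparr> pverts = carrier (cyclic_sum i ms),
      parcs = {(x, y). x \<in> carrier (cyclic_sum i ms) \<and> y \<in> carrier (cyclic_sum i ms) \<and> x \<noteq> y \<and>
                       (y = comp_mult i ms d x \<or> x = comp_mult i ms d y)} \<rparr>"

abbreviation graph_iso :: "'a pair_pre_digraph \<Rightarrow> 'b pair_pre_digraph \<Rightarrow> bool"
  where "graph_iso G G' \<equiv> digraph_iso (with_proj G) (with_proj G')"

lemma pair_graph_mult_graph:
  assumes "finite (carrier H)"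
  shows "pair_graph (mult_graph r H)"
proof
  show "finite (parcs (mult_graph r H))"
    by (rule finite_subset[of _ "carrier H \<times> carrier H"]) (use assms in \<open>auto simp: mult_graph_def\<close>)
  show "symmetric (with_proj (mult_graph r H))"
    by (auto simp: symmetric_def sym_def mult_graph_def)
qed (use assms in \<open>auto simp: mult_graph_def\<close>)

lemma carrier_cyclic_sum:
  "carrier (cyclic_sum i ms) = (\<Pi>\<^sub>E j\<in>{1..i}. carrier (integer_mod_group (ms j)))"
  by (simp add: cyclic_sum_def carrier_sum_group)

lemma pair_graph_product_graph:
  assumes "\<And>j. j \<in> {1..i} \<Longrightarrow> ms j > 0"
  shows "pair_graph (product_graph i d ms)"
proof
  have fin: "finite (carrier (cyclic_sum i ms))"
    unfolding carrier_cyclic_sum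
    by (rule finite_PiE) (use assms in \<open>auto simp: carrier_integer_mod_group\<close>)
  show "finite (pverts (product_graph i d ms))"
    using fin by (simp add: product_graph_def)
  show "finite (parcs (product_graph i d ms))"
    by (rule finite_subset[of _ "carrier (cyclic_sum i ms) \<times> carrier (cyclic_sum i ms)"])
      (use fin in \<open>auto simp: product_graph_def\<close>)
  show "symmetric (with_proj (product_graph i d ms))"
    by (auto simp: symmetric_def sym_def product_graph_def)
qed (auto simp: product_graph_def)

lemma gcd_admissible:
  fixes m n l :: nat
  assumes primes: "\<And>p. prime p \<Longrightarrow> p dvd n \<Longrightarrow> p dvd m" and "l dvd n" "l \<ge> 2"
  shows "gcd m l \<ge> 2" "gcd m l dvd l" "\<And>p. prime p \<Longrightarrow> p dvd l \<Longrightarrow> p dvd gcd m l"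
proof -
  show dvd: "p dvd gcd m l" if "prime p" "p dvd l" for p
    using that primes \<open>l dvd n\<close> by (meson dvd_trans gcd_greatest)
  obtain p where p: "prime p" "p dvd l"
    using \<open>l \<ge> 2\<close> prime_factor_nat[of l] by auto
  have "gcd m l > 0"
    using \<open>l \<ge> 2\<close> by simp
  then have "p \<le> gcd m l"
    using dvd[OF p] by (rule dvd_imp_le[rotated])
  then show "gcd m l \<ge> 2"
    using prime_ge_2_nat[OF p(1)] by simp
qed simp

text \<open>The library's isomorphism of digraphs is the usual one of simple graphs:\<close>

lemma graph_iso_iff:
  assumes "pair_wf_digraph G" "pair_wf_digraph G'"
  shows "graph_iso G G' \<longleftrightarrow>
    (\<exists>f. bij_betw f (pverts G) (pverts G') \<and>
         (\<forall>u\<in>pverts G. \<forall>v\<in>pverts G. (u, v) \<in> parcs G \<longleftrightarrow> (f u, f v) \<in> parcs G'))"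
    (is "?L \<longleftrightarrow> ?R")
proof
  interpret G: pair_wf_digraph G by fact
  interpret G': pair_wf_digraph G' by fact
  show ?R if ?L
  proof -
    from that obtain h where h: "pre_digraph.digraph_isomorphism (with_proj G) h"
      and eq: "with_proj G' = app_iso h (with_proj G)"
      by (auto simp: digraph_iso_def)
    have V: "pverts G' = iso_verts h ` pverts G" and A: "parcs G' = iso_arcs h ` parcs G"
      and "iso_tail h = fst" "iso_head h = snd"
      using eq by (auto simp: with_proj_def app_iso_def)
    then have arc: "iso_arcs h a = (iso_verts h (fst a), iso_verts h (snd a))" if "a \<in> parcs G" for a
      using h that by (auto simp: pre_digraph.digraph_isomorphism_def prod_eq_iff)
    have inj: "inj_on (iso_verts h) (pverts G)"
      using h by (simp add: pre_digraph.digraph_isomorphism_def)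
    have "(u, v) \<in> parcs G"
      if uv: "u \<in> pverts G" "v \<in> pverts G" "(iso_verts h u, iso_verts h v) \<in> parcs G'" for u v
    proof -
      obtain a where a: "a \<in> parcs G" "iso_arcs h a = (iso_verts h u, iso_verts h v)"
        using uv(3) A by auto
      have "fst a = u" "snd a = v"
        using arc[OF a(1)] a inj uv G.arc_fst_in_verts G.arc_snd_in_verts
        by (auto dest: inj_onD)
      then show ?thesis using a(1) by auto
    qed
    moreover have "(iso_verts h u, iso_verts h v) \<in> parcs G'" if "(u, v) \<in> parcs G" for u v
      using arc[OF that] that A by force
    ultimately show ?thesis
      using V inj by (auto simp: bij_betw_def intro!: exI[of _ "iso_verts h"])
  qed
  show ?L if ?R
  proof -
    from that obtain f where f: "bij_betw f (pverts G) (pverts G')"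
      and adj: "\<And>u v. u \<in> pverts G \<Longrightarrow> v \<in> pverts G \<Longrightarrow> (u, v) \<in> parcs G \<longleftrightarrow> (f u, f v) \<in> parcs G'"
      by blast
    define h where
      "h = \<lparr> iso_verts = f, iso_arcs = map_prod f f, iso_head = snd, iso_tail = fst \<rparr>"
    have inj: "inj_on f (pverts G)" and im: "f ` pverts G = pverts G'"
      using f by (auto simp: bij_betw_def)
    have sub: "parcs G \<subseteq> pverts G \<times> pverts G"
      using G.in_arcsD1 G.in_arcsD2 by auto
    have "inj_on (map_prod f f) (parcs G)"
      by (rule inj_on_subset[OF map_prod_inj_on[OF inj inj] sub])
    then have 1: "pre_digraph.digraph_isomorphism (with_proj G) h"
      using inj G.wf_digraph by (auto simp: pre_digraph.digraph_isomorphism_def h_def)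
    have "map_prod f f ` parcs G = parcs G'"
    proof (intro equalityI subsetI)
      show "e \<in> parcs G'" if "e \<in> map_prod f f ` parcs G" for e
        using that adj sub by auto
      show "e \<in> map_prod f f ` parcs G" if e: "e \<in> parcs G'" for e
      proof -
        obtain x y where xy: "e = (x, y)" by (cases e)
        then have "x \<in> f ` pverts G" "y \<in> f ` pverts G"
          using e G'.in_arcsD1 G'.in_arcsD2 im by auto
        then obtain u v where "u \<in> pverts G" "v \<in> pverts G" "x = f u" "y = f v"
          by auto
        then show ?thesis using adj[of u v] e xy by force
      qed
    qed
    then have "with_proj G' = app_iso h (with_proj G)"
      using im by (simp add: with_proj_def app_iso_def h_def)
    with 1 show ?thesis by (auto simp: digraph_iso_def)
  qed
qed

end

theory Submission
  imports Defs "HOL-Number_Theory.Cong"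
begin

text \<open>
  Each of the three graphs is the undirected graph of a self-map \<open>f\<close> of a set, with an edge between
  \<open>x\<close> and \<open>f x\<close> whenever they differ. A bijection that intertwines two such maps is an isomorphism
  of their graphs, so it suffices to conjugate the maps, and this can be done one cyclic summand at
  a time. Since \<open>gcd k (ms j) = gcd m (ms j) = d j\<close>, everything reduces to one fact about \<open>Z\<^sub>l\<close>: if
  \<open>gcd a l = gcd b l\<close> and every prime factor of \<open>l\<close> divides \<open>a\<close>, then multiplication by \<open>a\<close> and
  multiplication by \<open>b\<close> are conjugate (\<open>conjugate_mult_mod\<close>). By the Chinese remainder theorem it is
  enough to treat prime powers \<open>l = p\<^sup>e\<close>.

  There (\<open>conjugate_mult_prime_power\<close>), unless both maps are zero, \<open>a\<close> and \<open>b\<close> have the same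
  \<open>p\<close>-adic valuation \<open>v > 0\<close>, and \<open>b \<equiv> u a\<close> for a unit \<open>u\<close>. Multiplication by \<open>a\<close> raises valuations
  by \<open>v\<close>, so it raises \<open>h x = val x div v\<close> by exactly one until it reaches \<open>0\<close>. Hence
  \<open>\<phi> x = u ^ h x * x\<close> satisfies \<open>\<phi> (a x) = u ^ (h x + 1) * a x = b \<phi> x\<close>, and it is a bijection because
  multiplication by a unit preserves the valuation. The hypothesis on prime factors is what makes \<open>v\<close>
  positive; without it the claim fails, as \<open>1\<close> and \<open>-1\<close> act differently on \<open>Z\<^sub>3\<close>.
\<close>

section \<open>Conjugate self-maps\<close>

definition conjugate :: "'a set \<Rightarrow> ('a \<Rightarrow> 'a) \<Rightarrow> 'b set \<Rightarrow> ('b \<Rightarrow> 'b) \<Rightarrow> bool"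
  where "conjugate A f B g \<longleftrightarrow> (\<exists>\<phi>. bij_betw \<phi> A B \<and> (\<forall>x\<in>A. \<phi> (f x) = g (\<phi> x)))"

lemma conjugateI:
  assumes "bij_betw \<phi> A B" and "\<And>x. x \<in> A \<Longrightarrow> \<phi> (f x) = g (\<phi> x)"
  shows "conjugate A f B g"
  using assms by (auto simp: conjugate_def)

lemma conjugate_trans:
  assumes "conjugate A f B g" and "conjugate B g C h"
  shows "conjugate A f C h"
proof -
  obtain \<phi> \<psi> where "bij_betw \<phi> A B" "\<And>x. x \<in> A \<Longrightarrow> \<phi> (f x) = g (\<phi> x)"
    and "bij_betw \<psi> B C" "\<And>x. x \<in> B \<Longrightarrow> \<psi> (g x) = h (\<psi> x)"
    using assms by (auto simp: conjugate_def)
  then show ?thesis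
    by (intro conjugateI[of "\<psi> \<circ> \<phi>"]) (auto intro: bij_betw_trans simp: bij_betwE)
qed

lemma conjugate_sym:
  assumes "conjugate A f B g" and f: "f \<in> A \<rightarrow> A"
  shows "conjugate B g A f"
proof -
  obtain \<phi> where bij: "bij_betw \<phi> A B" and comm: "\<And>x. x \<in> A \<Longrightarrow> \<phi> (f x) = g (\<phi> x)"
    using assms by (auto simp: conjugate_def)
  show ?thesis
  proof (rule conjugateI)
    show "bij_betw (inv_into A \<phi>) B A"
      by (rule bij_betw_inv_into) fact
    fix y assume "y \<in> B"
    then obtain x where "x \<in> A" "y = \<phi> x"
      using bij by (auto simp: bij_betw_def)
    moreover from this f have "f x \<in> A"
      by auto
    ultimately show "inv_into A \<phi> (g y) = f (inv_into A \<phi> y)"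
      using bij by (simp add: bij_betw_inv_into_left flip: comm)
  qed
qed

lemma conjugate_Times:
  assumes "conjugate A f B g" and "conjugate A' f' B' g'"
  shows "conjugate (A \<times> A') (map_prod f f') (B \<times> B') (map_prod g g')"
proof -
  obtain \<phi> \<phi>' where "bij_betw \<phi> A B" "\<And>x. x \<in> A \<Longrightarrow> \<phi> (f x) = g (\<phi> x)"
    and "bij_betw \<phi>' A' B'" "\<And>x. x \<in> A' \<Longrightarrow> \<phi>' (f' x) = g' (\<phi>' x)"
    using assms by (auto simp: conjugate_def)
  then show ?thesis
    by (intro conjugateI[of "map_prod \<phi> \<phi>'"]) (auto intro: bij_betw_map_prod)
qed

lemma conjugate_PiE:
  assumes "\<And>j. j \<in> I \<Longrightarrow> conjugate (A j) (f j) (B j) (g j)"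
  shows "conjugate (\<Pi>\<^sub>E j\<in>I. A j) (\<lambda>x. \<lambda>j\<in>I. f j (x j)) (\<Pi>\<^sub>E j\<in>I. B j) (\<lambda>x. \<lambda>j\<in>I. g j (x j))"
proof -
  obtain \<phi> where bij: "\<And>j. j \<in> I \<Longrightarrow> bij_betw (\<phi> j) (A j) (B j)"
    and comm: "\<And>j x. j \<in> I \<Longrightarrow> x \<in> A j \<Longrightarrow> \<phi> j (f j x) = g j (\<phi> j x)"
    using assms unfolding conjugate_def by metis
  show ?thesis
  proof (rule conjugateI)
    show "bij_betw (\<lambda>x. \<lambda>j\<in>I. \<phi> j (x j)) (\<Pi>\<^sub>E j\<in>I. A j) (\<Pi>\<^sub>E j\<in>I. B j)"
    proof (rule bij_betw_byWitness[where f' = "\<lambda>y. \<lambda>j\<in>I. inv_into (A j) (\<phi> j) (y j)"])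
      show "\<forall>x\<in>\<Pi>\<^sub>E j\<in>I. A j. (\<lambda>j\<in>I. inv_into (A j) (\<phi> j) ((\<lambda>j\<in>I. \<phi> j (x j)) j)) = x"
        by (auto simp: fun_eq_iff PiE_iff extensional_def bij_betw_inv_into_left[OF bij])
      show "\<forall>y\<in>\<Pi>\<^sub>E j\<in>I. B j. (\<lambda>j\<in>I. \<phi> j ((\<lambda>j\<in>I. inv_into (A j) (\<phi> j) (y j)) j)) = y"
        by (auto simp: fun_eq_iff PiE_iff extensional_def bij_betw_inv_into_right[OF bij])
      show "(\<lambda>x. \<lambda>j\<in>I. \<phi> j (x j)) ` (\<Pi>\<^sub>E j\<in>I. A j) \<subseteq> (\<Pi>\<^sub>E j\<in>I. B j)"
        using bij bij_betwE by (fastforce simp: PiE_iff)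
      show "(\<lambda>y. \<lambda>j\<in>I. inv_into (A j) (\<phi> j) (y j)) ` (\<Pi>\<^sub>E j\<in>I. B j) \<subseteq> (\<Pi>\<^sub>E j\<in>I. A j)"
        using bij_betw_inv_into[OF bij] bij_betwE by (fastforce simp: PiE_iff)
    qed
  qed (auto simp: comm fun_eq_iff PiE_iff)
qed

section \<open>Graphs of self-maps\<close>

definition functional_graph :: "'a set \<Rightarrow> ('a \<Rightarrow> 'a) \<Rightarrow> 'a pair_pre_digraph"
  where "functional_graph A f =
    \<lparr> pverts = A, parcs = {(x, y). x \<in> A \<and> y \<in> A \<and> x \<noteq> y \<and> (f x = y \<or> f y = x)} \<rparr>"

lemma mult_graph_eq_functional_graph:
  "mult_graph r H = functional_graph (carrier H) (\<lambda>x. x [^]\<^bsub>H\<^esub> r)"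
  by (simp add: mult_graph_def functional_graph_def)

lemma product_graph_eq_functional_graph:
  "product_graph i d ms = functional_graph (carrier (cyclic_sum i ms)) (comp_mult i ms d)"
  by (auto simp: product_graph_def functional_graph_def)

lemma pair_wf_functional_graph: "pair_wf_digraph (functional_graph A f)"
  by unfold_locales (auto simp: functional_graph_def)

text \<open>
  As \<open>f\<close> maps \<open>A\<close> into itself, injectivity of the conjugating bijection on \<open>A\<close> turns the equation
  \<open>g (\<phi> x) = \<phi> y\<close> back into \<open>f x = y\<close>, so non-adjacency is preserved as well.
\<close>

lemma conjugate_imp_graph_iso:
  assumes "conjugate A f B g" and f: "f \<in> A \<rightarrow> A"
  shows "graph_iso (functional_graph A f) (functional_graph B g)"
proof -
  obtain \<phi> where bij: "bij_betw \<phi> A B" and comm: "\<And>x. x \<in> A \<Longrightarrow> \<phi> (f x) = g (\<phi> x)"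
    using assms by (auto simp: conjugate_def)
  have inj: "\<phi> x = \<phi> y \<longleftrightarrow> x = y" if "x \<in> A" "y \<in> A" for x y
    using bij that by (auto simp: bij_betw_def inj_on_eq_iff)
  have "g (\<phi> x) = \<phi> y \<longleftrightarrow> f x = y" if "x \<in> A" "y \<in> A" for x y
    using inj[of "f x" y] f that by (auto simp flip: comm)
  then show ?thesis
    unfolding graph_iso_iff[OF pair_wf_functional_graph pair_wf_functional_graph]
    using bij inj by (intro exI[of _ \<phi>]) (auto simp: functional_graph_def bij_betwE)
qed

section \<open>Multiplication maps modulo a number\<close>

text \<open>
  The valuation of a non-zero residue modulo \<open>p\<^sup>e\<close> is visible in the powers \<open>p\<^sup>s\<close> with \<open>s \<le> e\<close> alone.
  This is used both for congruent numbers and for numbers with the same gcd with \<open>p\<^sup>e\<close>.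
\<close>

lemma multiplicity_eq_if_dvd_iff:
  fixes p x y :: int
  assumes "\<And>s. s \<le> e \<Longrightarrow> p ^ s dvd x \<longleftrightarrow> p ^ s dvd y" and "\<not> p ^ e dvd x"
  shows "multiplicity p x = multiplicity p y"
proof -
  have less: "multiplicity p x < e"
    using assms(2) multiplicity_dvd'[of e p x] by force
  have "x \<noteq> 0" "\<not> is_unit p"
    using assms(2) unit_imp_dvd is_unit_power_iff by (auto simp del: zdvd1_eq)
  then have "p ^ multiplicity p x dvd x" "\<not> p ^ Suc (multiplicity p x) dvd x"
    by (simp_all add: multiplicity_dvd power_dvd_iff_le_multiplicity del: power_Suc)
  then show ?thesis
    using assms(1)[of "multiplicity p x"] assms(1)[of "Suc (multiplicity p x)"] less
    by (intro multiplicity_eqI[symmetric]) (simp_all del: power_Suc)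
qed

text \<open>
  The conjugating bijection multiplies \<open>x\<close> by \<open>u ^ h x\<close>, where \<open>u\<close> is a unit with \<open>b \<equiv> u a\<close> and \<open>h x\<close>
  is the number of times that a non-zero \<open>x\<close> can be divided by \<open>a\<close> within \<open>Z\<^bsub>p\<^sup>e\<^esub>\<close>: each
  application of the map contributes one more factor \<open>u\<close>.
\<close>

lemma conjugate_mult_prime_power:
  fixes p a b :: int
  assumes p: "prime p" and gcd: "gcd a (p ^ e) = gcd b (p ^ e)" and "e > 0 \<Longrightarrow> p dvd a"
  shows "conjugate {0..<p ^ e} (\<lambda>x. a * x mod p ^ e) {0..<p ^ e} (\<lambda>x. b * x mod p ^ e)"
proof (cases "p ^ e dvd a")
  case True
  then have "p ^ e dvd b"
    by (metis gcd gcd_greatest_iff dvd_refl)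
  with True show ?thesis
    by (intro conjugateI[of id]) (auto simp: mod_eq_0_iff_dvd)
next
  case False
  define v where "v = multiplicity p a"
  have pos: "p ^ e > 0"
    using p by (simp add: prime_gt_0_int)
  have nonunit: "\<not> is_unit p"
    using p by (metis not_prime_unit)
  have dvd_iff: "p ^ s dvd a \<longleftrightarrow> p ^ s dvd b" if "s \<le> e" for s
    using gcd le_imp_power_dvd[OF that, of p] by (metis dvd_trans gcd_dvd1 gcd_greatest)
  have "\<not> p ^ e dvd b"
    using False dvd_iff by blast
  have "a \<noteq> 0" "b \<noteq> 0"
    using False \<open>\<not> p ^ e dvd b\<close> by auto
  have "v < e"
    using False multiplicity_dvd'[of e p a] by (force simp: v_def)
  have "v > 0"
    using assms(3) \<open>v < e\<close> multiplicity_gt_zero_iff[OF \<open>a \<noteq> 0\<close> nonunit] by (simp add: v_def)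
  have "multiplicity p b = v"
    using multiplicity_eq_if_dvd_iff[of e p a b] dvd_iff False by (simp add: v_def)
  then obtain a' b' where a': "a = p ^ v * a'" "\<not> p dvd a'" and b': "b = p ^ v * b'" "\<not> p dvd b'"
    using multiplicity_decompose'[OF \<open>a \<noteq> 0\<close> nonunit] multiplicity_decompose'[OF \<open>b \<noteq> 0\<close> nonunit]
    by (metis v_def)
  have cop: "coprime c (p ^ e)" if "\<not> p dvd c" for c
    using prime_imp_coprime[OF p that] by (simp add: coprime_commute)
  obtain w where w: "[a' * w = 1] (mod p ^ e)"
    using cong_solve_coprime_int[OF cop[OF a'(2)]] by blast
  \<comment> \<open>the quotient of the unit parts of \<open>b\<close> and \<open>a\<close>\<close>
  define u where "u = b' * w"
  have "coprime w (p ^ e)"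
    using w by (metis coprime_iff_invertible_int mult.commute)
  then have "\<not> p dvd w"
    using \<open>v < e\<close> by (metis nonunit coprime_common_divisor dvd_power gr0I not_less_zero)
  then have u: "\<not> p dvd u ^ h" for h
    using \<open>\<not> p dvd w\<close> p b'(2) by (metis prime_dvd_mult_iff prime_dvd_power u_def)
  have ua: "[u * a = b] (mod p ^ e)"
  proof -
    have "u * a = b * (a' * w)"
      by (simp add: u_def a' b')
    then show ?thesis
      using cong_scalar_left[OF w, of b] by simp
  qed
  define h where "h x = multiplicity p x div v" for x
  define \<phi> where "\<phi> x = u ^ h x * x mod p ^ e" for x
  have mult_cong: "multiplicity p x = multiplicity p y"
    if "[x = y] (mod p ^ e)" "\<not> p ^ e dvd x" for x y
  proof -
    have iff: "p ^ s dvd x \<longleftrightarrow> p ^ s dvd y" if "s \<le> e" for s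
      using \<open>[x = y] (mod p ^ e)\<close> le_imp_power_dvd[OF that, of p]
      by (meson cong_dvd_iff cong_dvd_modulus)
    show ?thesis
      using iff that(2) by (rule multiplicity_eq_if_dvd_iff)
  qed
  have \<phi>_mult: "multiplicity p (\<phi> x) = multiplicity p x" if "\<not> p ^ e dvd x" for x
  proof -
    have "multiplicity p (u ^ h x * x) = multiplicity p x"
      using u[of "h x"] that prime_elem_multiplicity_mult_distrib[of p "u ^ h x" x] p
      by (metis add_0 dvd_0_right not_dvd_imp_multiplicity_0 prime_imp_prime_elem)
    moreover have "\<not> p ^ e dvd u ^ h x * x"
      using that cop[OF u[of "h x"]] by (simp add: coprime_dvd_mult_right_iff coprime_commute)
    ultimately show ?thesis
      using mult_cong[of "u ^ h x * x" "\<phi> x"] by (simp add: \<phi>_def cong_def)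
  qed
  have \<phi>_dvd: "p ^ e dvd \<phi> x \<longleftrightarrow> p ^ e dvd x" for x
    using cop[OF u[of "h x"]]
    by (simp add: \<phi>_def dvd_mod_iff coprime_dvd_mult_right_iff coprime_commute)
  have "inj_on \<phi> {0..<p ^ e}"
  proof (rule inj_onI)
    fix x y assume xy: "x \<in> {0..<p ^ e}" "y \<in> {0..<p ^ e}" "\<phi> x = \<phi> y"
    show "x = y"
    proof (cases "p ^ e dvd x")
      case True
      then have "p ^ e dvd y"
        using \<phi>_dvd xy(3) by metis
      with True xy show ?thesis
        by (auto dest!: zdvd_imp_le)
    next
      case False
      \<comment> \<open>\<open>\<phi>\<close> preserves the multiplicity, so both arguments were multiplied by the same unit\<close>
      then have "h x = h y"
        using \<phi>_mult[of x] \<phi>_mult[of y] \<phi>_dvd[of x] \<phi>_dvd[of y] xy(3) by (simp add: h_def)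
      then have "[u ^ h x * x = u ^ h x * y] (mod p ^ e)"
        using xy(3) by (simp add: \<phi>_def cong_def)
      then have "[x = y] (mod p ^ e)"
        using cong_mult_lcancel[OF cop[OF u]] by blast
      then show ?thesis
        using xy by (simp add: cong_def)
    qed
  qed
  moreover have "\<phi> ` {0..<p ^ e} \<subseteq> {0..<p ^ e}"
    using pos by (auto simp: \<phi>_def)
  ultimately have bij: "bij_betw \<phi> {0..<p ^ e} {0..<p ^ e}"
    by (simp add: bij_betw_def endo_inj_surj)
  have "\<phi> (a * x mod p ^ e) = b * \<phi> x mod p ^ e" if "x \<in> {0..<p ^ e}" for x
  proof -
    have "[b * \<phi> x = b * (u ^ h x * x)] (mod p ^ e)"
      by (auto simp: \<phi>_def intro: cong_scalar_left)
    moreover have "[b * (u ^ h x * x) = u * a * (u ^ h x * x)] (mod p ^ e)"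
      using cong_scalar_right[OF ua] by (simp add: cong_sym)
    ultimately have rhs: "[b * \<phi> x = u ^ Suc (h x) * (a * x)] (mod p ^ e)"
      by (simp add: ac_simps) (meson cong_trans)
    have lhs: "[\<phi> (a * x mod p ^ e) = u ^ h (a * x mod p ^ e) * (a * x)] (mod p ^ e)"
      by (simp add: \<phi>_def cong_def mod_mult_right_eq)
    have "[\<phi> (a * x mod p ^ e) = b * \<phi> x] (mod p ^ e)"
    proof (cases "p ^ e dvd a * x")
      \<comment> \<open>here \<open>h\<close> need not grow by one, but both sides vanish\<close>
      case True
      then show ?thesis
        using lhs rhs by (meson cong_dvd_iff cong_0_iff dvd_mult cong_sym cong_trans)
    next
      case False
      then have "x \<noteq> 0" by auto
      have "multiplicity p (a * x mod p ^ e) = multiplicity p (a * x)"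
        using mult_cong[OF _ False] by (metis cong_mod_right cong_refl)
      also have "\<dots> = v + multiplicity p x"
        unfolding v_def using \<open>x \<noteq> 0\<close> \<open>a \<noteq> 0\<close>
        by (intro prime_elem_multiplicity_mult_distrib prime_imp_prime_elem p)
      finally have "h (a * x mod p ^ e) = Suc (h x)"
        using \<open>v > 0\<close> by (simp add: h_def)
      then show ?thesis
        using lhs rhs by (metis cong_sym cong_trans)
    qed
    then show ?thesis
      by (simp add: cong_def \<phi>_def)
  qed
  with bij show ?thesis
    by (rule conjugateI)
qed

lemma conjugate_mult_CRT:
  fixes k l a :: int
  assumes "coprime k l" and "k > 0" and "l > 0"
  shows "conjugate {0..<k * l} (\<lambda>x. a * x mod (k * l))
    ({0..<k} \<times> {0..<l}) (map_prod (\<lambda>x. a * x mod k) (\<lambda>x. a * x mod l))"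
proof (rule conjugateI)
  let ?\<phi> = "\<lambda>x. (x mod k, x mod l)"
  have inj: "inj_on ?\<phi> {0..<k * l}"
  proof (rule inj_onI)
    fix x y assume xy: "x \<in> {0..<k * l}" "y \<in> {0..<k * l}" "?\<phi> x = ?\<phi> y"
    then have "[x = y] (mod k * l)"
      using assms by (intro coprime_cong_mult) (auto simp: cong_def)
    with xy show "x = y"
      by (simp add: cong_def)
  qed
  moreover have "?\<phi> ` {0..<k * l} = {0..<k} \<times> {0..<l}"
  proof (rule card_subset_eq)
    show "card (?\<phi> ` {0..<k * l}) = card ({0..<k} \<times> {0..<l})"
      using assms by (simp add: card_image[OF inj] card_cartesian_product nat_mult_distrib)
  qed (use assms in auto)
  ultimately show "bij_betw ?\<phi> {0..<k * l} ({0..<k} \<times> {0..<l})"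
    by (simp add: bij_betw_def)
qed (simp add: mod_mult_right_eq mod_mod_cancel)

text \<open>
  Induction on \<open>l\<close>, splitting off the full power of one prime. The gcd condition passes to every divisor
  \<open>t\<close> of \<open>l\<close>, because \<open>gcd x t = gcd (gcd x l) t\<close>.
\<close>

lemma conjugate_mult_mod:
  fixes l a b :: int
  assumes "l > 0" and "gcd a l = gcd b l" and "\<And>p. prime p \<Longrightarrow> p dvd l \<Longrightarrow> p dvd a"
  shows "conjugate {0..<l} (\<lambda>x. a * x mod l) {0..<l} (\<lambda>x. b * x mod l)"
  using assms
proof (induction l rule: measure_induct_rule[of nat])
  case (less l)
  show ?case
  proof (cases "l = 1")
    case True
    then show ?thesis
      by (intro conjugateI[of id]) auto
  next
    case False
    then obtain p where p: "prime p" "p dvd l"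
      using prime_factor_int[of l] less.prems(1) by auto
    have "p > 1" using p(1) by (rule prime_gt_1_int)
    have nonunit: "\<not> is_unit p"
      using p(1) by (metis not_prime_unit)
    obtain l' where l': "l = p ^ multiplicity p l * l'" "\<not> p dvd l'"
      using multiplicity_decompose'[OF _ nonunit, of l] less.prems(1) by (metis less_irrefl)
    define e where "e = multiplicity p l"
    have "e > 0"
      using p less.prems(1) multiplicity_gt_zero_iff[OF _ nonunit, of l] by (simp add: e_def)
    then have "p ^ e > 1"
      using \<open>p > 1\<close> by (intro one_less_power)
    have l: "l = p ^ e * l'" using l' by (simp add: e_def)
    have "l' > 0"
      using less.prems(1) \<open>p ^ e > 1\<close> by (metis l zero_less_mult_pos less_trans zero_less_one)
    have "l' < l"
      using \<open>l' > 0\<close> \<open>p ^ e > 1\<close> by (simp add: l)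
    have cop: "coprime (p ^ e) l'"
      using prime_imp_coprime[OF p(1) l'(2)] by simp
    have gcd_dvd: "gcd a t = gcd b t" if "t dvd l" for t
    proof -
      have "gcd x t = gcd (gcd x l) t" for x
        using that by (simp add: gcd.assoc)
      then show ?thesis
        using less.prems(2) by metis
    qed
    have 1: "conjugate {0..<p ^ e} (\<lambda>x. a * x mod p ^ e) {0..<p ^ e} (\<lambda>x. b * x mod p ^ e)"
      using p less.prems(3) by (intro conjugate_mult_prime_power gcd_dvd) (auto simp: l)
    have 2: "conjugate {0..<l'} (\<lambda>x. a * x mod l') {0..<l'} (\<lambda>x. b * x mod l')"
      using \<open>l' < l\<close> \<open>l' > 0\<close> less.prems(3)
      by (intro less.IH gcd_dvd) (auto simp: l)
    note crt = conjugate_mult_CRT[OF cop _ \<open>l' > 0\<close>]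
    have "conjugate ({0..<p ^ e} \<times> {0..<l'}) (map_prod (\<lambda>x. b * x mod p ^ e) (\<lambda>x. b * x mod l'))
      {0..<l} (\<lambda>x. b * x mod l)"
      unfolding l using \<open>p ^ e > 1\<close> \<open>l' > 0\<close> by (intro conjugate_sym[OF crt]) auto
    moreover have "conjugate {0..<l} (\<lambda>x. a * x mod l)
      ({0..<p ^ e} \<times> {0..<l'}) (map_prod (\<lambda>x. a * x mod p ^ e) (\<lambda>x. a * x mod l'))"
      unfolding l using \<open>p ^ e > 1\<close> by (intro crt) auto
    ultimately show ?thesis
      using conjugate_Times[OF 1 2] by (blast intro: conjugate_trans)
  qed
qed

section \<open>Transfer to abelian groups\<close>

lemma pow_cyclic_sum:
  assumes "x \<in> carrier (cyclic_sum i ms)"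
  shows "x [^]\<^bsub>cyclic_sum i ms\<^esub> r = comp_mult i ms (\<lambda>_. r) x"
  by (induction r) (auto simp: cyclic_sum_def comp_mult_def fun_eq_iff mod_add_right_eq algebra_simps)

lemma conjugate_iso_pow:
  assumes "group G" and "group K" and "G \<cong> K"
  shows "conjugate (carrier G) (\<lambda>x. x [^]\<^bsub>G\<^esub> (r::nat)) (carrier K) (\<lambda>x. x [^]\<^bsub>K\<^esub> r)"
proof -
  obtain \<phi> where \<phi>: "\<phi> \<in> iso G K"
    using assms(3) by (auto simp: is_iso_def)
  then interpret group_hom G K \<phi>
    using assms by (simp add: group_hom_def group_hom_axioms_def iso_def)
  show ?thesis
    using \<phi> by (intro conjugateI[of \<phi>]) (auto simp: iso_def hom_nat_pow)
qed

lemma conjugate_comp_mult: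
  assumes "\<And>j. j \<in> {1..i} \<Longrightarrow> ms j > 0"
    and "\<And>j. j \<in> {1..i} \<Longrightarrow> gcd (c j) (ms j) = gcd (d j) (ms j)"
    and "\<And>j p. j \<in> {1..i} \<Longrightarrow> prime p \<Longrightarrow> p dvd ms j \<Longrightarrow> p dvd c j"
  shows "conjugate (carrier (cyclic_sum i ms)) (comp_mult i ms c)
    (carrier (cyclic_sum i ms)) (comp_mult i ms d)"
  unfolding carrier_cyclic_sum comp_mult_def[abs_def]
proof (rule conjugate_PiE)
  fix j assume j: "j \<in> {1..i}"
  have "p dvd int (c j)" if p: "prime p" "p dvd int (ms j)" for p
  proof -
    obtain q where "p = int q"
      using prime_ge_0_int[OF p(1)] by (blast elim: nonneg_int_cases)
    then show ?thesis
      using assms(3)[OF j, of q] p by simp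
  qed
  then have "conjugate {0..<int (ms j)} (\<lambda>x. int (c j) * x mod int (ms j))
      {0..<int (ms j)} (\<lambda>x. int (d j) * x mod int (ms j))"
    using assms(1,2)[OF j] by (intro conjugate_mult_mod) simp_all
  then show "conjugate (carrier (integer_mod_group (ms j)))
      (\<lambda>x. x [^]\<^bsub>integer_mod_group (ms j)\<^esub> c j)
      (carrier (integer_mod_group (ms j))) (\<lambda>x. x [^]\<^bsub>integer_mod_group (ms j)\<^esub> d j)"
    using assms(1)[OF j] by (simp add: carrier_integer_mod_group)
qed

text \<open>
  In this form the lemma applies to \<open>r = m\<close> and to \<open>r = k\<close> with the same \<open>d\<close>, so the product graph
  serves as the common model of the two other graphs.
\<close>

lemma conjugate_pow_comp_mult:
  assumes "group H" and "H \<cong> cyclic_sum i ms"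
    and "\<And>j. j \<in> {1..i} \<Longrightarrow> ms j > 0"
    and "\<And>j. j \<in> {1..i} \<Longrightarrow> gcd r (ms j) = d j"
    and "\<And>j p. j \<in> {1..i} \<Longrightarrow> prime p \<Longrightarrow> p dvd ms j \<Longrightarrow> p dvd r"
  shows "conjugate (carrier H) (\<lambda>x. x [^]\<^bsub>H\<^esub> r) (carrier (cyclic_sum i ms)) (comp_mult i ms d)"
proof -
  have "group (cyclic_sum i ms)"
    by (simp add: cyclic_sum_def)
  then have "conjugate (carrier H) (\<lambda>x. x [^]\<^bsub>H\<^esub> r)
      (carrier (cyclic_sum i ms)) (\<lambda>x. x [^]\<^bsub>cyclic_sum i ms\<^esub> r)"
    using assms(1,2) by (intro conjugate_iso_pow)
  moreover have "conjugate (carrier (cyclic_sum i ms)) (\<lambda>x. x [^]\<^bsub>cyclic_sum i ms\<^esub> r)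
      (carrier (cyclic_sum i ms)) (comp_mult i ms (\<lambda>_. r))"
    by (rule conjugateI[of id]) (simp_all add: pow_cyclic_sum)
  moreover have "conjugate (carrier (cyclic_sum i ms)) (comp_mult i ms (\<lambda>_. r))
      (carrier (cyclic_sum i ms)) (comp_mult i ms d)"
    by (intro conjugate_comp_mult) (use assms(3-) in \<open>auto simp flip: assms(4)\<close>)
  ultimately show ?thesis
    by (blast intro: conjugate_trans)
qed

theorem theorem4p4:
  fixes H :: "('a, 'b) monoid_scheme"
    and i n m k :: nat
    and ms d :: "nat \<Rightarrow> nat"
  assumes "comm_group H" and "\<not> cyclic_group H"
    and "order H = n" and "n > 1" and "\<not> prime n"
    and "i \<ge> 2" and "ms 1 \<ge> 2"
    and "\<forall>j\<in>{1..<i}. ms j dvd ms (Suc j)"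
    and "H \<cong> cyclic_sum i ms"
    and "n = (\<Prod>j\<in>{1..i}. ms j)"
    and "m > 1" and "\<forall>p. prime p \<and> p dvd n \<longrightarrow> p dvd m"
    and "k = gcd m n"
    and "\<forall>j\<in>{1..i}. d j = gcd m (ms j)"
  shows "(\<forall>j\<in>{1..i}. d j = gcd k (ms j))
    \<and> graph_iso (mult_graph m H) (mult_graph k H)
    \<and> graph_iso (mult_graph k H) (product_graph i d ms)"
proof -
  interpret comm_group H by fact
  have dvd: "ms j dvd n" if "j \<in> {1..i}" for j
    using that by (simp add: assms(10) dvd_prodI)
  then have pos: "ms j > 0" if "j \<in> {1..i}" for j
    using that \<open>n > 1\<close> by (metis dvd_0_left gr0I not_less_zero)
  have dk: "d j = gcd k (ms j)" if "j \<in> {1..i}" for j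
    using that assms(13,14) dvd[OF that] by (simp add: gcd.assoc gcd_proj2_iff)
  have primes: "p dvd m" "p dvd k" if "j \<in> {1..i}" "prime p" "p dvd ms j" for j p
  proof -
    have "p dvd n"
      using that dvd by (blast intro: dvd_trans)
    then show "p dvd m"
      using that(2) assms(12) by blast
    with \<open>p dvd n\<close> show "p dvd k"
      unfolding assms(13) by (intro gcd_greatest)
  qed
  note conj = conjugate_pow_comp_mult[OF group_axioms assms(9) pos]
  have m: "conjugate (carrier H) (\<lambda>x. x [^]\<^bsub>H\<^esub> m) (carrier (cyclic_sum i ms)) (comp_mult i ms d)"
    by (rule conj) (use primes assms(14) in auto)
  have k: "conjugate (carrier H) (\<lambda>x. x [^]\<^bsub>H\<^esub> k) (carrier (cyclic_sum i ms)) (comp_mult i ms d)"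
    by (rule conj) (use primes dk in auto)
  have "conjugate (carrier H) (\<lambda>x. x [^]\<^bsub>H\<^esub> m) (carrier H) (\<lambda>x. x [^]\<^bsub>H\<^esub> k)"
    by (rule conjugate_trans[OF m conjugate_sym[OF k]]) auto
  then show ?thesis
    unfolding mult_graph_eq_functional_graph product_graph_eq_functional_graph
    using k by (intro conjI ballI dk conjugate_imp_graph_iso) simp_all
qed

end
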